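(* Let $G$ be a graph whose vertex set is partitioned into two global offensive alliances $X_1$ and $X_2$, and let $H$ be a graph whose vertex set is partitioned into two global strong offensive alliances $Y_1$ and $Y_2$. Then $$\gamma_o(G\Box H)\le |X_1||Y_1|+|X_2||Y_2|.$$
   Context: All graphs are finite and simple. For a graph with vertex set $V$, a vertex $v$ and $S\subseteq V$, let $\delta_S(v)=|N(v)\cap S|$ and $\overline{S}=V\setminus S$. A nonempty set $S\subseteq V$ is a global offensive alliance if $\delta_S(v)\ge \delta_{\overline{S}}(v)+1$ for every $v\in\overline{S}$; $\gamma_o(G)$ is the minimum cardinality of a global offensive alliance of $G$. A set $S\subseteq V$ is a global strong offensive alliance if $\delta_S(x)\ge \delta_{\overline{S}}(x)$ for every $x\in\overline{S}$. $G\Box H$ is the Cartesian product: vertex set $V(G)\times V(H)$, with $(a,b)\sim(c,d)$ iff ($a=c$ and $b\sim d$ in $H$) or ($a\sim c$ in $G$ and $b=d$). *)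

theory Defs
  imports "Graph_Theory.Pair_Digraph"
begin

text \<open>
  A finite simple graph is a \<open>pair_graph\<close>: a finite vertex set together with a symmetric,
  loop-free set of arcs, each undirected edge being represented by its two opposite arcs.
  The vertex set of a \<open>pair_graph\<close> may be empty.
\<close>

definition neighborhood :: "'a pair_pre_digraph \<Rightarrow> 'a \<Rightarrow> 'a set" where
  "neighborhood G v = {u. (v, u) \<in> parcs G}"

definition deg_in :: "'a pair_pre_digraph \<Rightarrow> 'a set \<Rightarrow> 'a \<Rightarrow> nat" where
  "deg_in G S v = card (neighborhood G v \<inter> S)"

definition global_offensive_alliance :: "'a pair_pre_digraph \<Rightarrow> 'a set \<Rightarrow> bool" where
  "global_offensive_alliance G S \<longleftrightarrow>
     S \<noteq> {} \<and> S \<subseteq> pverts G \<and>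
     (\<forall>v \<in> pverts G - S. deg_in G S v \<ge> deg_in G (pverts G - S) v + 1)"

definition global_strong_offensive_alliance :: "'a pair_pre_digraph \<Rightarrow> 'a set \<Rightarrow> bool" where
  "global_strong_offensive_alliance G S \<longleftrightarrow>
     S \<subseteq> pverts G \<and>
     (\<forall>v \<in> pverts G - S. deg_in G S v \<ge> deg_in G (pverts G - S) v)"

text \<open>
  For a finite graph with at least one vertex the whole vertex set is a global offensive
  alliance, so the minimum exists; for the graph without vertices \<open>Min\<close> is taken over the
  empty set and the value is unspecified.
\<close>

definition global_offensive_alliance_number :: "'a pair_pre_digraph \<Rightarrow> nat" where
  "global_offensive_alliance_number G = Min (card ` {S. global_offensive_alliance G S})"

definition cartesian_product ::
  "'a pair_pre_digraph \<Rightarrow> 'b pair_pre_digraph \<Rightarrow> ('a \<times> 'b) pair_pre_digraph" where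
  "cartesian_product G H =
     \<lparr> pverts = pverts G \<times> pverts H,
       parcs = {((a, b), (c, d)) | a b c d.
         (a, b) \<in> pverts G \<times> pverts H \<and> (c, d) \<in> pverts G \<times> pverts H \<and>
         (a = c \<and> (b, d) \<in> parcs H \<or> (a, c) \<in> parcs G \<and> b = d)} \<rparr>"

end

theory Submission
  imports Defs
begin

text \<open>
  The set \<open>S = X1 \<times> Y1 \<union> X2 \<times> Y2\<close> is a global offensive alliance of the product. The neighbours
  of \<open>(a, b)\<close> split into a copy of those of \<open>a\<close> and a copy of those of \<open>b\<close>; if \<open>(a, b)\<close> lies
  outside \<open>S\<close>, then in the row of \<open>b\<close> the trace of \<open>S\<close> is the part of \<open>G\<close> not containing \<open>a\<close>,
  and in the column of \<open>a\<close> it is the part of \<open>H\<close> not containing \<open>b\<close>. The alliance inequalities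
  of the two factors therefore add up, and the strict one comes from \<open>G\<close>.
\<close>

lemma pverts_cartesian_product [simp]:
  "pverts (cartesian_product G H) = pverts G \<times> pverts H"
  by (simp add: cartesian_product_def)

lemma (in pair_graph) finite_neighborhood: "finite (neighborhood G v)"
proof -
  have "neighborhood G v \<subseteq> pverts G"
    using in_arcsD2 by (auto simp: neighborhood_def)
  then show ?thesis
    using pair_finite_verts finite_subset by blast
qed

text \<open>The arcs of the product carry explicit membership conditions; they hold because
  \<open>a\<close> and \<open>b\<close> are vertices and \<open>in_arcsD2\<close> makes every
  neighbour a vertex of its factor.\<close>

lemma neighborhood_cartesian_product:
  assumes "pair_graph G" "pair_graph H" "a \<in> pverts G" "b \<in> pverts H"
  shows "neighborhood (cartesian_product G H) (a, b) =
    (\<lambda>c. (c, b)) ` neighborhood G a \<union> Pair a ` neighborhood H b"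
proof -
  interpret G: pair_graph G by fact
  interpret H: pair_graph H by fact
  show ?thesis
    using assms(3,4) G.in_arcsD2 H.in_arcsD2
    by (auto simp: neighborhood_def cartesian_product_def)
qed

text \<open>Degrees add because the two copies of neighbourhoods are disjoint. \<open>S\<close> is
  arbitrary, so that the formula serves both the alliance and its complement.\<close>

lemma deg_in_cartesian_product:
  assumes "pair_graph G" "pair_graph H" "a \<in> pverts G" "b \<in> pverts H"
  shows "deg_in (cartesian_product G H) S (a, b) =
    deg_in G {c. (c, b) \<in> S} a + deg_in H {d. (a, d) \<in> S} b"
proof -
  interpret G: pair_graph G by fact
  interpret H: pair_graph H by fact
  let ?A = "neighborhood G a \<inter> {c. (c, b) \<in> S}" and ?B = "neighborhood H b \<inter> {d. (a, d) \<in> S}"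
  have "neighborhood (cartesian_product G H) (a, b) \<inter> S = (\<lambda>c. (c, b)) ` ?A \<union> Pair a ` ?B"
    using neighborhood_cartesian_product[OF assms] by auto
  \<comment> \<open>A common element could only be \<open>(a, b)\<close> itself, which would give a
    loop at \<open>a\<close> in \<open>G\<close>.\<close>
  moreover have "(\<lambda>c. (c, b)) ` ?A \<inter> Pair a ` ?B = {}"
    by (auto simp: neighborhood_def dest: G.pair_no_loops)
  moreover have "finite ?A" "finite ?B"
    using G.finite_neighborhood H.finite_neighborhood by auto
  ultimately show ?thesis
    by (simp add: deg_in_def card_Un_disjoint card_image inj_on_def)
qed

lemma global_offensive_alliance_number_le:
  assumes "finite (pverts G)" "global_offensive_alliance G S"
  shows "global_offensive_alliance_number G \<le> card S"
proof -
  have "{S. global_offensive_alliance G S} \<subseteq> Pow (pverts G)"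
    by (auto simp: global_offensive_alliance_def)
  then have "finite {S. global_offensive_alliance G S}"
    by (rule finite_subset) (simp add: assms(1))
  then show ?thesis
    unfolding global_offensive_alliance_number_def using assms(2) by (intro Min_le) auto
qed

lemma global_offensive_alliance_cartesian_product:
  assumes "pair_graph G" "pair_graph H" "pverts H \<noteq> {}"
    and X: "X1 \<union> X2 = pverts G" "X1 \<inter> X2 = {}"
    and X1: "global_offensive_alliance G X1" and X2: "global_offensive_alliance G X2"
    and Y: "Y1 \<union> Y2 = pverts H" "Y1 \<inter> Y2 = {}"
    and Y1: "global_strong_offensive_alliance H Y1" and Y2: "global_strong_offensive_alliance H Y2"
  shows "global_offensive_alliance (cartesian_product G H) (X1 \<times> Y1 \<union> X2 \<times> Y2)"
    (is "global_offensive_alliance ?P ?S")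
proof -
  have compl: "pverts G - X1 = X2" "pverts G - X2 = X1" "pverts H - Y1 = Y2" "pverts H - Y2 = Y1"
    using X Y by auto
  have ineq: "deg_in ?P ?S v \<ge> deg_in ?P (pverts ?P - ?S) v + 1" if v: "v \<in> pverts ?P - ?S" for v
  proof -
    obtain a b where ab: "v = (a, b)" by (cases v)
    with v have mem: "a \<in> pverts G" "b \<in> pverts H" by auto
    note deg = deg_in_cartesian_product[OF assms(1,2) mem]
    \<comment> \<open>The complement of \<open>?S\<close> is
      \<open>X1 \<times> Y2 \<union> X2 \<times> Y1\<close>.\<close>
    from v ab X Y consider "a \<in> X1" "b \<in> Y2" | "a \<in> X2" "b \<in> Y1" by auto
    then show ?thesis
    proof cases
      case 1
      then have traces: "{c. (c, b) \<in> ?S} = X2" "{d. (a, d) \<in> ?S} = Y1"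
        "{c. (c, b) \<in> pverts ?P - ?S} = X1" "{d. (a, d) \<in> pverts ?P - ?S} = Y2"
        using X(2) Y(2) by (auto simp flip: X(1) Y(1))
      \<comment> \<open>\<open>a\<close> lies outside \<open>X2\<close> and \<open>b\<close> outside
        \<open>Y1\<close>, so these are the two alliances whose inequalities apply.\<close>
      have "deg_in G X2 a \<ge> deg_in G X1 a + 1" "deg_in H Y1 b \<ge> deg_in H Y2 b"
        using X2 Y1 1 compl
        by (auto simp: global_offensive_alliance_def global_strong_offensive_alliance_def)
      then show ?thesis
        unfolding ab deg traces by linarith
    next
      case 2
      then have traces: "{c. (c, b) \<in> ?S} = X1" "{d. (a, d) \<in> ?S} = Y2"
        "{c. (c, b) \<in> pverts ?P - ?S} = X2" "{d. (a, d) \<in> pverts ?P - ?S} = Y1"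
        using X(2) Y(2) by (auto simp flip: X(1) Y(1))
      have "deg_in G X1 a \<ge> deg_in G X2 a + 1" "deg_in H Y2 b \<ge> deg_in H Y1 b"
        using X1 Y2 2 compl
        by (auto simp: global_offensive_alliance_def global_strong_offensive_alliance_def)
      then show ?thesis
        unfolding ab deg traces by linarith
    qed
  qed
  \<comment> \<open>A strong alliance may be empty, but some vertex of \<open>H\<close> lies in
    \<open>Y1\<close> or \<open>Y2\<close>, and both \<open>X1\<close> and \<open>X2\<close> are
    nonempty.\<close>
  moreover have "?S \<noteq> {}"
    using X1 X2 Y(1) assms(3) by (auto simp: global_offensive_alliance_def)
  moreover have "?S \<subseteq> pverts ?P"
    using X(1) Y(1) by auto
  ultimately show ?thesis
    unfolding global_offensive_alliance_def by blast
qed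

theorem theorem14:
  fixes G :: "'a pair_pre_digraph" and H :: "'b pair_pre_digraph"
    and X1 X2 :: "'a set" and Y1 Y2 :: "'b set"
  assumes "pair_graph G" and "pair_graph H"
    and "pverts H \<noteq> {}"
    and "X1 \<union> X2 = pverts G" and "X1 \<inter> X2 = {}"
    and "global_offensive_alliance G X1" and "global_offensive_alliance G X2"
    and "Y1 \<union> Y2 = pverts H" and "Y1 \<inter> Y2 = {}"
    and "global_strong_offensive_alliance H Y1" and "global_strong_offensive_alliance H Y2"
  shows "global_offensive_alliance_number (cartesian_product G H)
           \<le> card X1 * card Y1 + card X2 * card Y2"
proof -
  interpret G: pair_graph G by fact
  interpret H: pair_graph H by fact
  have fin: "finite (X1 \<union> X2)" "finite (Y1 \<union> Y2)"
    using assms(4,8) G.pair_finite_verts H.pair_finite_verts by auto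
  have "global_offensive_alliance_number (cartesian_product G H)
      \<le> card (X1 \<times> Y1 \<union> X2 \<times> Y2)"
    using G.pair_finite_verts H.pair_finite_verts
      global_offensive_alliance_cartesian_product[OF assms]
    by (intro global_offensive_alliance_number_le) auto
  \<comment> \<open>The products are disjoint because their first coordinates lie in the disjoint
    sets \<open>X1\<close> and \<open>X2\<close>.\<close>
  also have "\<dots> = card (X1 \<times> Y1) + card (X2 \<times> Y2)"
    using fin assms(5) by (intro card_Un_disjoint) auto
  finally show ?thesis
    by (simp add: card_cartesian_product)
qed

end
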